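(* For $n\ge0$ let $s_n=\mathrm{ct}\left[(x^{-1}+1+x)^n(1+x)\right]$, and let $p$ be a prime. The asymptotic density $D_0$ of $0$ in $(s_n\bmod p)_{n\ge0}$ is $1$ if $p\mid T_n$ for some $0\le n<p$, and otherwise, for $p>2$, it is $$D_0=\frac{\left|\{0\le m<p-1 : T_m\equiv -T_{p-1}T_{m+1}\}\right|+p\left|\{0\le m<p-1 : T_m\equiv -T_{m+1}\}\right|}{(p-1)(p+1)},$$ where $m$ ranges over integers and congruences are modulo $p$. Additionally, for $p>2$, $D_0\geq\frac{1}{p-1}$.
   Context: For a Laurent polynomial $Q(x)$, $\mathrm{ct}[Q(x)]$ denotes its constant term. $T_n=\mathrm{ct}\left[(x^{-1}+1+x)^n\right]$ for $n\ge0$ (central trinomial coefficients). The sequence $s_n$ is OEIS A005773. The asymptotic density of a set $S\subseteq\mathbb{N}=\{0,1,2,\dots\}$ is $\lim_{N\to\infty}\frac{|S\cap\{n\in\mathbb{N}: n<N\}|}{N}$; the density of a value $x\in\mathbb{F}_p$ in a sequence $(c_n)$ over $\mathbb{F}_p$ is the asymptotic density of $\{n\in\mathbb{N}: c_n=x\}$. Saying that a density equals a number includes the assertion that the limit exists. *)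

theory Defs
  imports Complex_Main "HOL-Library.Poly_Mapping" "HOL-Number_Theory.Number_Theory"
begin

(* The Laurent polynomial ring over the integers: finitely supported maps from int (exponents)
   to int (coefficients), whose product in Poly_Mapping is the convolution product. *)
type_synonym laurent_poly = "int \<Rightarrow>\<^sub>0 int"

definition X :: laurent_poly where
  "X = Poly_Mapping.single 1 1"

definition X_inv :: laurent_poly where
  "X_inv = Poly_Mapping.single (- 1) 1"

definition ct :: "laurent_poly \<Rightarrow> int" where
  "ct Q = Poly_Mapping.lookup Q 0"

definition T :: "nat \<Rightarrow> int" where
  "T n = ct ((X_inv + 1 + X) ^ n)"

definition s :: "nat \<Rightarrow> int" where
  "s n = ct ((X_inv + 1 + X) ^ n * (1 + X))"

(* A relation rather than a function, so that it includes the existence of the limit.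
   The quotient at N = 0 is 0 / 0 = 0, which does not affect the limit. *)
definition has_asymptotic_density :: "nat set \<Rightarrow> real \<Rightarrow> bool" where
  "has_asymptotic_density S d \<longleftrightarrow>
     (\<lambda>N. real (card (S \<inter> {n. n < N})) / real N) \<longlonglongrightarrow> d"

(* For sequences over the field with p elements, values are represented by their
   residues in {0..<p}. *)
definition has_value_density :: "(nat \<Rightarrow> 'a) \<Rightarrow> 'a \<Rightarrow> real \<Rightarrow> bool" where
  "has_value_density c x d \<longleftrightarrow> has_asymptotic_density {n. c n = x} d"

end

theory Submission
  imports Defs
begin

text \<open>
  Since \<open>2 s\<^sub>n = T\<^sub>n + T\<^sub>n\<^sub>+\<^sub>1\<close>, for odd \<open>p\<close> one asks when \<open>T\<^sub>n + T\<^sub>n\<^sub>+\<^sub>1\<close> vanishes modulo \<open>p\<close>.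
  The Lucas congruence \<open>T\<^sub>p\<^sub>k\<^sub>+\<^sub>m \<equiv> T\<^sub>k T\<^sub>m\<close> reads \<open>T\<^sub>n\<close> off the base-\<open>p\<close> digits of \<open>n\<close>.
  If some digit \<open>j\<close> has \<open>T\<^sub>j \<equiv> 0\<close>, almost every \<open>n\<close> contains it, and so does almost every
  \<open>n + 1\<close>.
  Otherwise let \<open>S\<^sub>e = {n. e T\<^sub>n + T\<^sub>n\<^sub>+\<^sub>1 \<equiv> 0}\<close> and \<open>t = T\<^sub>p\<^sub>-\<^sub>1\<close>. For \<open>m < p - 1\<close>, membership of
  \<open>p k + m\<close> in \<open>S\<^sub>e\<close> depends only on \<open>m\<close>, while a last digit \<open>p - 1\<close> carries, and
  \<open>p k + (p - 1)\<close> lies in \<open>S\<^sub>e\<close> iff \<open>k\<close> lies in \<open>S\<^sub>e\<^sub>t\<close>. As \<open>t\<^sup>2 \<equiv> 1\<close>, the sets \<open>S\<^sub>1\<close> and \<open>S\<^sub>t\<close>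
  are exchanged, which yields two linear equations for their densities. For the lower bound,
  both counts in the numerator are positive: the three-term recurrence gives
  \<open>T\<^sub>p\<^sub>-\<^sub>3 + T\<^sub>p\<^sub>-\<^sub>2 \<equiv> 0\<close>, the two counts agree if \<open>t \<equiv> 1\<close>, and \<open>m = 0\<close> contributes to the first
  if \<open>t \<equiv> -1\<close>.
\<close>

section \<open>Central trinomial coefficients modulo a prime\<close>

text \<open>All coefficients of the power are kept, since the step from \<open>n\<close> to
  \<open>Suc n\<close> mixes neighbouring exponents; \<open>T\<close> is the column
  \<open>k = 0\<close>.\<close>

definition tri :: "nat \<Rightarrow> int \<Rightarrow> int" where
  "tri n k = Poly_Mapping.lookup ((X_inv + 1 + X) ^ n) k"

lemma lookup_single_times:
  fixes Q :: "int \<Rightarrow>\<^sub>0 int"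
  shows "Poly_Mapping.lookup (Poly_Mapping.single a c * Q) k = c * Poly_Mapping.lookup Q (k - a)"
proof -
  have "(k = a + q) = (q = k - a)" for q by auto
  then show ?thesis
    by (simp add: lookup_mult lookup_single when_mult)
qed

lemma lookup_X_times: "Poly_Mapping.lookup (X * Q) k = Poly_Mapping.lookup Q (k - 1)"
  and lookup_X_inv_times: "Poly_Mapping.lookup (X_inv * Q) k = Poly_Mapping.lookup Q (k + 1)"
  by (simp_all add: X_def X_inv_def lookup_single_times)

lemma X_power: "X ^ n = Poly_Mapping.single (int n) 1"
  by (induction n) (simp_all add: X_def mult_single algebra_simps)

lemma X_inv_power: "X_inv ^ n = Poly_Mapping.single (- int n) 1"
  by (induction n) (simp_all add: X_inv_def mult_single algebra_simps)

lemma tri_0: "tri 0 k = (if k = 0 then 1 else 0)"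
  by (simp add: tri_def lookup_one when_def)

lemma tri_Suc: "tri (Suc n) k = tri n (k - 1) + tri n k + tri n (k + 1)"
  by (simp add: tri_def distrib_right lookup_add lookup_X_times lookup_X_inv_times)

lemma tri_uminus: "tri n (- k) = tri n k"
proof (induction n arbitrary: k)
  case (Suc n)
  have "- k - 1 = - (k + 1)" "- k + 1 = - (k - 1)" by auto
  then show ?case by (simp only: tri_Suc Suc.IH)
qed (simp add: tri_0)

lemma tri_eq_0: "int n < \<bar>k\<bar> \<Longrightarrow> tri n k = 0"
  by (induction n arbitrary: k) (auto simp: tri_0 tri_Suc)

lemma tri_self: "tri n (int n) = 1"
  by (induction n) (auto simp: tri_0 tri_Suc tri_eq_0)

lemma T_eq_tri: "T n = tri n 0"
  by (simp add: T_def tri_def ct_def)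

lemma T_Suc: "T (Suc n) = T n + 2 * tri n 1"
  using tri_uminus[of n 1] by (simp add: T_eq_tri tri_Suc)

lemma two_s: "2 * s n = T n + T (Suc n)"
proof -
  have "s n = T n + tri n (- 1)"
    by (simp add: s_def ct_def T_def tri_def distrib_left lookup_add lookup_X_times
        mult.commute[of _ X])
  then show ?thesis by (simp add: T_Suc tri_uminus)
qed

text \<open>The coefficients of \<open>x \<cdot> d/dx P\<^sup>n\<^sup>+\<^sup>1 = (n + 1) P\<^sup>n (x - x\<^sup>-\<^sup>1)\<close> for
  \<open>P = x\<^sup>-\<^sup>1 + 1 + x\<close>.\<close>

lemma tri_derivative:
  "k * tri (Suc n) k = (int n + 1) * (tri n (k - 1) - tri n (k + 1))"
proof (induction n arbitrary: k)
  case 0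
  show ?case by (auto simp: tri_0 tri_Suc)
next
  case (Suc n)
  have "k * tri (Suc (Suc n)) k =
      (k - 1) * tri (Suc n) (k - 1) + k * tri (Suc n) k + (k + 1) * tri (Suc n) (k + 1)
      + (tri (Suc n) (k - 1) - tri (Suc n) (k + 1))"
    by (simp only: tri_Suc[of "Suc n"]) (simp add: algebra_simps)
  also have "\<dots> = (int (Suc n) + 1) * (tri (Suc n) (k - 1) - tri (Suc n) (k + 1))"
    by (simp only: Suc.IH) (simp add: tri_Suc algebra_simps)
  finally show ?case .
qed

text \<open>Eliminate \<open>tri n 2\<close> between the expansion of \<open>tri (Suc n) 1\<close>
  and the derivative identity at exponent 1; \<open>T_Suc\<close> then turns the coefficients at 1
  into differences of \<open>T\<close>.\<close>

lemma T_recurrence: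
  "(int n + 2) * T (Suc (Suc n)) = (2 * int n + 3) * T (Suc n) + 3 * (int n + 1) * T n"
proof -
  have U: "tri (Suc n) 1 = T n + tri n 1 + tri n 2"
    by (simp add: T_eq_tri tri_Suc)
  have "tri (Suc n) 1 = (int n + 1) * (T n - tri n 2)"
    using tri_derivative[of 1 n] by (simp add: T_eq_tri)
  then have "(int n + 2) * tri (Suc n) 1 = (int n + 1) * (2 * T n + tri n 1)"
    unfolding U by (simp add: algebra_simps)
  then show ?thesis
    by (simp add: T_Suc algebra_simps)
qed

section \<open>Frobenius and the Lucas congruence\<close>

lemma prime_dvd_binomial_expansion:
  fixes a b :: "'a :: comm_ring_1"
  assumes "prime p"
  shows "of_nat p dvd (a + b) ^ p - (a ^ p + b ^ p)"
proof -
  have p: "p > 0" using assms prime_gt_0_nat by blast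
  have "(a + b) ^ p = (\<Sum>k\<le>p. of_nat (p choose k) * a ^ k * b ^ (p - k))"
    by (rule binomial_ring)
  also have "{..p} = insert 0 (insert p {0<..<p})" by auto
  also have "(\<Sum>k\<in>insert 0 (insert p {0<..<p}). of_nat (p choose k) * a ^ k * b ^ (p - k)) =
      b ^ p + (a ^ p + (\<Sum>k\<in>{0<..<p}. of_nat (p choose k) * a ^ k * b ^ (p - k)))"
    using p by simp
  finally have "(a + b) ^ p - (a ^ p + b ^ p) =
      (\<Sum>k\<in>{0<..<p}. of_nat (p choose k) * a ^ k * b ^ (p - k))"
    by simp
  also have "of_nat p dvd \<dots>"
  proof (rule dvd_sum)
    fix k assume "k \<in> {0<..<p}"
    then have "p dvd p choose k"
      using assms by (intro dvd_choose_prime) auto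
    then have "(of_nat p :: 'a) dvd of_nat (p choose k)"
      by (auto elim!: dvdE)
    then show "of_nat p dvd of_nat (p choose k) * a ^ k * b ^ (p - k)"
      by (simp add: dvd_mult2)
  qed
  finally show ?thesis .
qed

lemma dvd_lookup:
  fixes Q :: "int \<Rightarrow>\<^sub>0 int"
  assumes "of_nat p dvd Q"
  shows "int p dvd Poly_Mapping.lookup Q k"
proof -
  obtain R where "Q = of_nat p * R" using assms by blast
  then have "Q = Poly_Mapping.single 0 (int p) * R" by simp
  then show ?thesis by (simp only: lookup_single_times dvd_triv_left)
qed

text \<open>Modulo p, the p-th power of the trinomial is \<open>X_inv ^ p + 1 + X ^ p\<close>, so
  multiplying by it adds two shifts by p.\<close>

lemma tri_add_prime:
  assumes "prime p"
  shows "[tri (p + n) k = tri n (k - int p) + tri n k + tri n (k + int p)] (mod int p)"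
proof -
  let ?P = "X_inv + 1 + X"
  have "of_nat p dvd (?P ^ p - ((X_inv + 1) ^ p + X ^ p)) + ((X_inv + 1) ^ p - (X_inv ^ p + 1 ^ p))"
    by (intro dvd_add prime_dvd_binomial_expansion assms)
  then have "of_nat p dvd ?P ^ p - (X_inv ^ p + 1 + X ^ p)"
    by (simp add: algebra_simps)
  then have "of_nat p dvd (?P ^ p - (X_inv ^ p + 1 + X ^ p)) * ?P ^ n"
    by (rule dvd_mult2)
  also have "(?P ^ p - (X_inv ^ p + 1 + X ^ p)) * ?P ^ n =
      ?P ^ (p + n) - (X_inv ^ p * ?P ^ n + ?P ^ n + X ^ p * ?P ^ n)"
    by (simp add: algebra_simps power_add)
  finally have "int p dvd Poly_Mapping.lookup
      (?P ^ (p + n) - (X_inv ^ p * ?P ^ n + ?P ^ n + X ^ p * ?P ^ n)) k"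
    by (rule dvd_lookup)
  then have "int p dvd tri (p + n) k - (tri n (k + int p) + tri n k + tri n (k - int p))"
    by (simp add: tri_def lookup_minus lookup_add X_power X_inv_power lookup_single_times)
  then show ?thesis
    by (simp add: cong_iff_dvd_diff add_ac)
qed

text \<open>On exponents divisible by p, \<open>tri_add_prime\<close> repeats the recursion
  \<open>tri_Suc\<close> in \<open>n\<close>. General \<open>k\<close> is needed for the induction;
  in the base case \<open>m < p\<close> leaves only \<open>k = 0\<close> within the degree.\<close>

lemma tri_Lucas:
  assumes "prime p" "m < p"
  shows "[tri (p * n + m) (int p * k) = tri n k * T m] (mod int p)"
proof (induction n arbitrary: k)
  case 0
  have "tri m (int p * k) = tri 0 k * T m"
  proof (cases "k = 0")
    case False
    then have "int p * 1 \<le> int p * \<bar>k\<bar>" by (intro mult_left_mono) auto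
    moreover have "int m < int p" using assms(2) by simp
    ultimately have "int m < int p * \<bar>k\<bar>" by linarith
    then have "int m < \<bar>int p * k\<bar>" by (simp add: abs_mult)
    then show ?thesis using False by (simp add: tri_eq_0 tri_0)
  qed (simp add: tri_0 T_eq_tri)
  then show ?case by simp
next
  case (Suc n)
  let ?N = "p * n + m"
  have "[tri (p + ?N) (int p * k) = tri ?N (int p * k - int p) + tri ?N (int p * k)
      + tri ?N (int p * k + int p)] (mod int p)"
    by (rule tri_add_prime) fact
  also have "tri ?N (int p * k - int p) + tri ?N (int p * k) + tri ?N (int p * k + int p) =
      tri ?N (int p * (k - 1)) + tri ?N (int p * k) + tri ?N (int p * (k + 1))"
    by (simp add: algebra_simps)
  also have "[\<dots> = tri n (k - 1) * T m + tri n k * T m + tri n (k + 1) * T m] (mod int p)"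
    by (intro cong_add Suc.IH)
  finally show ?case
    by (simp add: tri_Suc algebra_simps)
qed

lemma T_Lucas:
  assumes "prime p" "m < p"
  shows "[T (p * n + m) = T n * T m] (mod int p)"
  using tri_Lucas[OF assms, of n 0] by (simp add: T_eq_tri)

lemma T_0: "T 0 = 1" and T_1: "T (Suc 0) = 1"
  by (simp_all add: T_eq_tri tri_Suc tri_0)

text \<open>Modulo \<open>p\<close>, \<open>P \<cdot> P\<^sup>p\<^sup>-\<^sup>1 = x\<^sup>-\<^sup>p + 1 + x\<^sup>p\<close>, so the coefficients of \<open>P\<^sup>p\<^sup>-\<^sup>1\<close> read
  downwards from \<open>x\<^sup>p\<^sup>-\<^sup>1\<close> to \<open>x\<^sup>0\<close> have vanishing sums over three consecutive exponents.\<close>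

lemma tri_pred_prime:
  assumes "prime p" "i < p"
  shows "[tri (p - 1) (int p - 1 - int i) =
    (if i mod 3 = 0 then 1 else if i mod 3 = 1 then -1 else 0)] (mod int p)"
  using assms(2)
proof (induction i rule: less_induct)
  case (less i)
  let ?b = "\<lambda>i::nat. (if i mod 3 = 0 then 1 else if i mod 3 = 1 then -1 else 0) :: int"
  have p: "Suc (p - 1) = p" using less.prems by simp
  show ?case
  proof (cases i)
    case 0
    then show ?thesis using p tri_self[of "p - 1"] by (simp add: of_nat_diff)
  next
    case (Suc j)
    have "tri p (int p - int i) = tri (p - 1) (int p - 1 - int i) + tri (p - 1) (int p - int i)
        + tri (p - 1) (int p - int i + 1)"
      using tri_Suc[of "p - 1" "int p - int i"] p by (simp add: algebra_simps)
    \<comment> \<open>The exponents -i, p - i and 2p - i are all nonzero because 0 < i < p.\<close>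
    moreover have "[tri p (int p - int i) = 0] (mod int p)"
      using tri_add_prime[OF assms(1), of 0 "int p - int i"] Suc less.prems by (simp add: tri_0)
    ultimately have *: "[tri (p - 1) (int p - 1 - int i) + tri (p - 1) (int p - int i)
        + tri (p - 1) (int p - int i + 1) = 0] (mod int p)"
      by simp
    have b1: "[tri (p - 1) (int p - int i) = ?b j] (mod int p)"
      using less.IH[of j] Suc less.prems by (simp add: algebra_simps)
    \<comment> \<open>For \<open>j = 0\<close> the exponent is p, beyond the degree p - 1; otherwise
      the pattern 1, -1, 0 sums to zero over three consecutive indices.\<close>
    have b2: "[tri (p - 1) (int p - int i + 1) = - ?b j - ?b i] (mod int p)"
    proof (cases j)
      case 0
      then show ?thesis using Suc p less.prems by (simp add: tri_eq_0)
    next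
      case (Suc l)
      have "- ?b j - ?b i = ?b l"
        using Suc \<open>i = Suc j\<close> mod_less_divisor[of 3 l] by (auto simp: mod_Suc)
      then show ?thesis
        using less.IH[of l] Suc \<open>i = Suc j\<close> less.prems by (simp add: algebra_simps)
    qed
    have "[tri (p - 1) (int p - 1 - int i) + tri (p - 1) (int p - int i)
        + tri (p - 1) (int p - int i + 1) - tri (p - 1) (int p - int i)
        - tri (p - 1) (int p - int i + 1) = 0 - ?b j - (- ?b j - ?b i)] (mod int p)"
      by (intro cong_diff * b1 b2)
    then show ?thesis by simp
  qed
qed

text \<open>The constant term is entry \<open>i = p - 1\<close> of the pattern 1, -1, 0, and the
  value 0 is excluded.\<close>

lemma T_pred_prime_square:
  assumes "prime p" "\<not> int p dvd T (p - 1)"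
  shows "[T (p - 1) * T (p - 1) = 1] (mod int p)"
proof -
  have "p > 0" using assms(1) prime_gt_0_nat by blast
  then have "[T (p - 1) = (if (p - 1) mod 3 = 0 then 1 else if (p - 1) mod 3 = 1 then -1 else 0)]
      (mod int p)"
    using tri_pred_prime[OF assms(1), of "p - 1"] by (simp add: T_eq_tri of_nat_diff)
  then obtain b where b: "[T (p - 1) = b] (mod int p)" "b \<in> {0, 1, -1}"
    by (auto split: if_splits)
  have "b \<noteq> 0" using b(1) assms(2) by (auto simp: cong_0_iff)
  then have "b * b = 1" using b(2) by auto
  then show ?thesis using cong_mult[OF b(1) b(1)] by simp
qed

text \<open>Modulo \<open>p\<close>, the recurrence gives \<open>T\<^sub>p\<^sub>-\<^sub>1 = -3 T\<^sub>p\<^sub>-\<^sub>2\<close> and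
  \<open>T\<^sub>p\<^sub>-\<^sub>1 = 3 T\<^sub>p\<^sub>-\<^sub>2 + 6 T\<^sub>p\<^sub>-\<^sub>3\<close>.\<close>

lemma prime_dvd_T_sum:
  assumes "prime p" "p > 3"
  shows "int p dvd T (p - 3) + T (p - 2)"
proof -
  define m where "m = p - 3"
  have p: "p = m + 3" using assms(2) by (simp add: m_def)
  have 1: "int p * T (Suc (Suc (Suc m))) = (2 * int p - 1) * T (Suc (Suc m)) + 3 * (int p - 1) * T (Suc m)"
    using T_recurrence[of "Suc m"] p by (simp add: algebra_simps)
  have 2: "(int p - 1) * T (Suc (Suc m)) = (2 * int p - 3) * T (Suc m) + 3 * (int p - 2) * T m"
    using T_recurrence[of m] p by (simp add: algebra_simps)
  \<comment> \<open>Add \<open>1\<close> and \<open>2\<close> and collect the multiples of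
    p.\<close>
  have "6 * (T m + T (Suc m)) = int p * (T (Suc (Suc m)) + 5 * T (Suc m) + 3 * T m - T (Suc (Suc (Suc m))))"
    using 1 2 by (simp add: algebra_simps)
  then have "int p dvd 6 * (T m + T (Suc m))" by simp
  moreover have "\<not> int p dvd 6"
  proof
    assume "int p dvd 6"
    then have "p dvd 2 * 3"
      by (metis int_dvd_int_iff mult_numeral_1_right num_double numeral_times_numeral of_nat_numeral)
    then have "p dvd 2 \<or> p dvd 3" using assms(1) prime_dvd_multD by blast
    then show False using assms(2) by (auto dest!: dvd_imp_le)
  qed
  ultimately have "int p dvd T m + T (Suc m)"
    using assms(1) by (simp add: prime_dvd_mult_iff del: distrib_left_numeral)
  then show ?thesis using p by (simp add: numeral_eq_Suc)
qed

section \<open>Densities of sets given by base-\<open>p\<close> digits\<close>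

text \<open>Applying \<open>step\<close> j times shrinks the slope of the linear bound to
  \<open>M * (a / p) ^ j\<close>. The additive constant depends on j, but for fixed j it vanishes
  after division by n.\<close>

lemma digit_recursion_sublinear:
  fixes f :: "nat \<Rightarrow> real" and p :: nat and a L M :: real
  assumes "0 \<le> a" "a < real p"
    and nonneg: "\<And>n. 0 \<le> f n"
    and linear: "\<And>n. f n \<le> M * real n"
    and step: "\<And>n. f n \<le> a * f (n div p) + L"
  shows "(\<lambda>n. f n / real n) \<longlonglongrightarrow> 0"
proof -
  have "0 \<le> M" using nonneg[of 1] linear[of 1] by simp
  have ratio: "0 \<le> a / p" "a / p < 1" using assms(1,2) by auto
  have bound: "\<exists>K. \<forall>n. f n \<le> M * (a / p) ^ j * real n + K" for j
  proof (induction j)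
    case 0
    show ?case using linear by (intro exI[of _ 0]) simp
  next
    case (Suc j)
    then obtain K where K: "\<And>n. f n \<le> M * (a / p) ^ j * real n + K" by blast
    have "f n \<le> M * (a / p) ^ Suc j * real n + (a * K + L)" for n
    proof -
      have "f (n div p) \<le> M * (a / p) ^ j * real (n div p) + K" by (rule K)
      also have "\<dots> \<le> M * (a / p) ^ j * (real n / real p) + K"
        using \<open>0 \<le> M\<close> ratio(1)
        by (intro add_right_mono mult_left_mono of_nat_div_le_of_nat) auto
      finally have "a * f (n div p) \<le> a * (M * (a / p) ^ j * (real n / real p) + K)"
        using assms(1) by (rule mult_left_mono)
      then show ?thesis using step[of n] by (simp add: algebra_simps)
    qed
    then show ?case by blast
  qed
  show ?thesis
  proof (rule LIMSEQ_I)
    fix r :: real assume "0 < r"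
    have "(\<lambda>j. M * (a / p) ^ j) \<longlonglongrightarrow> M * 0"
      using ratio by (intro tendsto_mult_left LIMSEQ_realpow_zero) auto
    then have "\<forall>\<^sub>F j in sequentially. M * (a / p) ^ j < r / 2"
      using \<open>0 < r\<close> by (intro order_tendstoD) auto
    then obtain j where j: "M * (a / p) ^ j < r / 2"
      by (auto simp: eventually_sequentially)
    obtain K where K: "\<And>n. f n \<le> M * (a / p) ^ j * real n + K" using bound by blast
    obtain N :: nat where N: "2 * \<bar>K\<bar> / r < real N" using reals_Archimedean2 by blast
    have "norm (f n / real n - 0) < r" if "n \<ge> Suc N" for n
    proof -
      have n: "0 < real n" using that by simp
      have "2 * \<bar>K\<bar> / r < real n" using N that by linarith
      then have "K < r / 2 * real n" using \<open>0 < r\<close> by (simp add: field_simps)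
      moreover have "M * (a / p) ^ j * real n < r / 2 * real n"
        using j n by (rule mult_strict_right_mono)
      ultimately have "f n < r * real n" using K[of n] by linarith
      then show ?thesis using n nonneg[of n] by (simp add: field_simps)
    qed
    then show "\<exists>no. \<forall>n\<ge>no. norm (f n / real n - 0) < r" by blast
  qed
qed

section \<open>Counting by blocks of length p\<close>

abbreviation count_below :: "nat set \<Rightarrow> nat \<Rightarrow> nat" where
  "count_below S N \<equiv> card (S \<inter> {..<N})"

lemma has_asymptotic_density_iff:
  "has_asymptotic_density S d \<longleftrightarrow> (\<lambda>N. real (count_below S N) / real N) \<longlonglongrightarrow> d"
  by (simp add: has_asymptotic_density_def lessThan_def)

lemma count_below_add_eq:
  "count_below S (a + b) = count_below S a + card {m. m < b \<and> a + m \<in> S}"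
proof -
  have "S \<inter> {..<a + b} = S \<inter> {..<a} \<union> (+) a ` {m. m < b \<and> a + m \<in> S}"
    by (auto simp: image_iff) (metis add_diff_inverse_nat nat_add_left_cancel_less)
  moreover have "S \<inter> {..<a} \<inter> (+) a ` {m. m < b \<and> a + m \<in> S} = {}" by auto
  ultimately show ?thesis
    by (simp add: card_Un_disjoint card_image)
qed

lemma count_below_mult:
  "count_below S (p * n) = (\<Sum>k<n. card {m. m < p \<and> p * k + m \<in> S})"
  by (induction n) (simp_all add: count_below_add_eq add.commute[of p])

lemma count_below_div:
  assumes "0 < p"
  shows "count_below S (p * (n div p)) \<le> count_below S n"
    and "count_below S n \<le> count_below S (p * (n div p)) + p"
proof -
  have "count_below S n = count_below S (p * (n div p) + n mod p)" by simp
  also have "\<dots> = count_below S (p * (n div p)) + card {m. m < n mod p \<and> p * (n div p) + m \<in> S}"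
    by (rule count_below_add_eq)
  finally have eq: "count_below S n = \<dots>" .
  have "card {m. m < n mod p \<and> p * (n div p) + m \<in> S} \<le> card {..<n mod p}"
    by (intro card_mono) auto
  also have "\<dots> \<le> p" using assms by (simp add: less_imp_le)
  finally show "count_below S n \<le> count_below S (p * (n div p)) + p" using eq by simp
  show "count_below S (p * (n div p)) \<le> count_below S n" using eq by simp
qed

lemma count_below_le: "count_below S n \<le> n"
  using card_mono[of "{..<n}" "S \<inter> {..<n}"] by simp

text \<open>Each k in \<open>S\<close> has at most p - 1 extensions by a digit and every other k has
  none, so the count obeys the digit recursion with factor p - 1; the added p covers an incomplete
  last block.\<close>

lemma density_digit_closed:
  assumes "j < p"
    and missing: "\<And>k. p * k + j \<notin> S"
    and closed: "\<And>k m. m < p \<Longrightarrow> p * k + m \<in> S \<Longrightarrow> k \<in> S"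
  shows "has_asymptotic_density S 0"
  unfolding has_asymptotic_density_iff
proof (rule digit_recursion_sublinear)
  show "0 \<le> real (p - 1)" "real (p - 1) < real p" using assms(1) by auto
  show "real (count_below S n) \<le> 1 * real n" for n using count_below_le by simp
  show "real (count_below S n) \<le> real (p - 1) * real (count_below S (n div p)) + real p" for n
  proof -
    have "card {m. m < p \<and> p * k + m \<in> S} \<le> (if k \<in> S then p - 1 else 0)" for k
    proof (cases "k \<in> S")
      case True
      have "card {m. m < p \<and> p * k + m \<in> S} \<le> card ({..<p} - {j})"
        using missing by (intro card_mono) auto
      then show ?thesis using True assms(1) by simp
    next
      case False
      then have "{m. m < p \<and> p * k + m \<in> S} = {}" using closed by blast
      then show ?thesis by (simp only: card.empty)
    qed
    then have "count_below S (p * (n div p)) \<le> (\<Sum>k<n div p. if k \<in> S then p - 1 else 0)"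
      unfolding count_below_mult by (intro sum_mono)
    also have "\<dots> = (p - 1) * count_below S (n div p)"
      by (simp add: sum.If_cases Int_commute mult.commute)
    finally have "count_below S n \<le> (p - 1) * count_below S (n div p) + p"
      using count_below_div(2)[of p S n] assms(1) by simp
    then show ?thesis by (metis of_nat_add of_nat_le_iff of_nat_mult)
  qed
qed simp

text \<open>With \<open>D\<close>, \<open>D'\<close> the solution of \<open>p D = C + D'\<close>, \<open>p D' = C' + D\<close>, the total error
  \<open>\<bar>|S \<inter> [0,n)| - D n\<bar> + \<bar>|S' \<inter> [0,n)| - D' n\<bar>\<close> grows by a bounded
  amount for each base-\<open>p\<close> digit of \<open>n\<close>.\<close>

lemma density_digit_swap:
  fixes S S' :: "nat set" and p C C' :: nat
  assumes p: "1 < p"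
    and S: "\<And>k. card {m. m < p \<and> p * k + m \<in> S} = C + (if k \<in> S' then 1 else 0)"
    and S': "\<And>k. card {m. m < p \<and> p * k + m \<in> S'} = C' + (if k \<in> S then 1 else 0)"
  shows "has_asymptotic_density S ((real C' + real p * real C) / ((real p - 1) * (real p + 1)))"
proof -
  define D where "D = (real C' + real p * real C) / ((real p - 1) * (real p + 1))"
  define D' where "D' = (real C + real p * real C') / ((real p - 1) * (real p + 1))"
  have nz: "real p - 1 \<noteq> 0" "real p + 1 \<noteq> 0" using p by auto
  have D: "real p * D = real C + D'" "real p * D' = real C' + D"
    using nz unfolding D_def D'_def by (simp_all add: divide_simps) (simp_all add: algebra_simps)
  let ?c = "\<lambda>S n. real (count_below S n)"
  have mult: "?c S (p * q) = real q * real C + ?c S' q" "?c S' (p * q) = real q * real C' + ?c S q" for q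
    by (simp_all add: count_below_mult S S' sum.distrib sum.If_cases Int_commute)
  \<comment> \<open>Cutting n back to a multiple of p loses at most p elements and moves
    \<open>d * n\<close> by at most \<open>\<bar>d\<bar> * p\<close>.\<close>
  have err: "\<bar>?c A n - d * n\<bar> \<le> \<bar>?c A (p * (n div p)) - d * (p * (n div p))\<bar> + (p + \<bar>d\<bar> * p)"
    for A n and d :: real
  proof -
    have 1: "\<bar>?c A n - ?c A (p * (n div p))\<bar> \<le> p"
      using count_below_div[of p A n] p by (simp add: abs_le_iff)
    have "real n = real (p * (n div p)) + real (n mod p)"
      by (metis mult_div_mod_eq of_nat_add)
    then have 2: "d * n - d * (p * (n div p)) = d * real (n mod p)"
      by (simp add: algebra_simps)
    have "\<bar>d * real (n mod p)\<bar> \<le> \<bar>d\<bar> * p"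
      using p by (simp add: abs_mult mult_left_mono less_imp_le)
    with 1 2 show ?thesis by linarith
  qed
  define f where "f n = \<bar>?c S n - D * n\<bar> + \<bar>?c S' n - D' * n\<bar>" for n
  have "(\<lambda>n. f n / real n) \<longlonglongrightarrow> 0"
  proof (rule digit_recursion_sublinear)
    show "0 \<le> (1::real)" "1 < real p" using p by auto
    show "0 \<le> f n" for n by (simp add: f_def)
    show "f n \<le> (2 + \<bar>D\<bar> + \<bar>D'\<bar>) * real n" for n
    proof -
      have "\<bar>?c A n - d * n\<bar> \<le> n + \<bar>d\<bar> * n" for A and d :: real
      proof -
        have "\<bar>?c A n - d * n\<bar> \<le> \<bar>?c A n\<bar> + \<bar>d * n\<bar>" by (rule abs_triangle_ineq4)
        then show ?thesis using count_below_le[of A n] by (simp add: abs_mult)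
      qed
      from this[of S D] this[of S' D'] show ?thesis
        unfolding f_def by (simp add: algebra_simps)
    qed
    show "f n \<le> 1 * f (n div p) + ((p + \<bar>D\<bar> * p) + (p + \<bar>D'\<bar> * p))" for n
    proof -
      let ?q = "n div p"
      \<comment> \<open>At multiples of p the error of \<open>S\<close> equals that of
        \<open>S'\<close> one digit earlier, and conversely, so the summed error recurs with factor
        1, which is below p.\<close>
      have "?c S (p * ?q) - D * (p * ?q) = ?c S' ?q + (real C - real p * D) * ?q"
        by (simp add: mult algebra_simps)
      also have "\<dots> = ?c S' ?q - D' * ?q" by (simp add: D)
      finally have 1: "?c S (p * ?q) - D * (p * ?q) = ?c S' ?q - D' * ?q" .
      have "?c S' (p * ?q) - D' * (p * ?q) = ?c S ?q + (real C' - real p * D') * ?q"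
        by (simp add: mult algebra_simps)
      also have "\<dots> = ?c S ?q - D * ?q" by (simp add: D)
      finally have 2: "?c S' (p * ?q) - D' * (p * ?q) = ?c S ?q - D * ?q" .
      show ?thesis
        using add_mono[OF err[of S n D] err[of S' n D']] unfolding 1 2 f_def by simp
    qed
  qed
  then have "(\<lambda>n. ?c S n / real n - D) \<longlonglongrightarrow> 0"
  proof (rule tendsto_0_le)
    show "\<forall>\<^sub>F n in sequentially. norm (?c S n / real n - D) \<le> norm (f n / real n) * 1"
      using eventually_gt_at_top[of 0]
    proof eventually_elim
      case (elim n)
      then have "?c S n / real n - D = (?c S n - D * n) / real n" by (simp add: field_simps)
      then show ?case using elim by (simp add: f_def divide_right_mono)
    qed
  qed
  then show ?thesis
    unfolding has_asymptotic_density_iff D_def by (simp add: LIM_zero_iff)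
qed

section \<open>Zeros of the sequence\<close>

text \<open>By Lucas, a nonzero \<open>T (p * k + m)\<close> forces a nonzero \<open>T k\<close>,
  and the last digit j forces zero.\<close>

lemma T_dvd_density:
  assumes "prime p" "j < p" "int p dvd T j"
  shows "has_asymptotic_density {n. \<not> int p dvd T n} 0"
proof (rule density_digit_closed)
  have dvd: "int p dvd T (p * k + m) \<longleftrightarrow> int p dvd T k * T m" if "m < p" for k m
    by (rule cong_dvd_iff[OF T_Lucas]) (use assms that in auto)
  show "j < p" by fact
  show "p * k + j \<notin> {n. \<not> int p dvd T n}" for k using dvd[of j k] assms by simp
  show "k \<in> {n. \<not> int p dvd T n}" if "m < p" "p * k + m \<in> {n. \<not> int p dvd T n}" for k m
    using dvd[of m k] that by auto
qed

lemma has_asymptotic_density_superset_complement_shift: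
  assumes "has_asymptotic_density Z 0" and S: "\<And>n. n \<notin> Z \<Longrightarrow> Suc n \<notin> Z \<Longrightarrow> n \<in> S"
  shows "has_asymptotic_density S 1"
proof -
  have bound: "real N \<le> real (count_below S N) + 2 * real (count_below Z N) + 1" for N
  proof -
    let ?A = "Z \<inter> {..<N}" and ?B = "{n. Suc n \<in> Z} \<inter> {..<N}"
    have "{..<N} \<subseteq> (S \<inter> {..<N}) \<union> (?A \<union> ?B)" using S by auto
    then have "card {..<N} \<le> card ((S \<inter> {..<N}) \<union> (?A \<union> ?B))" by (intro card_mono) auto
    also have "\<dots> \<le> count_below S N + (card ?A + card ?B)"
      by (meson card_Un_le add_left_mono le_trans)
    finally have 1: "N \<le> count_below S N + (card ?A + card ?B)" by simp
    have "card ?B = card (Suc ` ?B)" by (simp add: card_image)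
    \<comment> \<open>Shifting moves the set into the numbers up to N, hence the extra element
      N.\<close>
    also have "\<dots> \<le> card (insert N ?A)" by (intro card_mono) auto
    also have "\<dots> \<le> card ?A + 1" by (simp add: card_insert_if)
    finally show ?thesis using 1 by linarith
  qed
  have "(\<lambda>N. 1 - (2 * (real (count_below Z N) / real N) + 1 / real N)) \<longlonglongrightarrow> 1 - (2 * 0 + 0)"
    using assms(1) unfolding has_asymptotic_density_iff
    by (intro tendsto_intros lim_1_over_n)
  then have lim: "(\<lambda>N. 1 - (2 * (real (count_below Z N) / real N) + 1 / real N)) \<longlonglongrightarrow> 1" by simp
  show ?thesis
    unfolding has_asymptotic_density_iff
  proof (rule tendsto_sandwich[OF _ _ lim tendsto_const])
    show "\<forall>\<^sub>F N in sequentially. 1 - (2 * (real (count_below Z N) / real N) + 1 / real N)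
        \<le> real (count_below S N) / real N"
      using eventually_gt_at_top[of 0]
    proof eventually_elim
      case (elim N)
      have "real N - (2 * real (count_below Z N) + 1) \<le> real (count_below S N)"
        using bound[of N] by simp
      then have "(real N - (2 * real (count_below Z N) + 1)) / real N \<le> real (count_below S N) / real N"
        by (rule divide_right_mono) simp
      then show ?case using elim by (simp add: diff_divide_distrib add_divide_distrib)
    qed
    show "\<forall>\<^sub>F N in sequentially. real (count_below S N) / real N \<le> 1"
      using count_below_le[of S] by (intro always_eventually) (auto simp: divide_le_eq_1)
  qed
qed

lemma card_lessThan_split_last:
  fixes p :: nat
  assumes "0 < p"
  shows "card {m. m < p \<and> P m} = card {m. m < p - 1 \<and> P m} + (if P (p - 1) then 1 else 0)"
proof -
  have "m < p \<longleftrightarrow> m < p - 1 \<or> m = p - 1" for m using assms by linarith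
  then have "{m. m < p \<and> P m} = {m. m < p - 1 \<and> P m} \<union> (if P (p - 1) then {p - 1} else {})"
    by auto
  moreover have "finite {m. m < p - 1 \<and> P m}" by simp
  ultimately show ?thesis by simp
qed

text \<open>The parameter \<open>e\<close> makes the family of sets stable under the carry. Stating
  \<open>e'\<close> only up to congruence lets the square of \<open>T (p - 1)\<close> be replaced by
  1.\<close>

lemma T_digit_count:
  assumes "prime p" and nz: "\<And>n. n < p \<Longrightarrow> \<not> int p dvd T n"
    and e: "[e * T (p - 1) = e'] (mod int p)"
  shows "card {m. m < p \<and> p * k + m \<in> {n. int p dvd e * T n + T (Suc n)}} =
    card {m. m < p - 1 \<and> int p dvd e * T m + T (Suc m)} +
    (if k \<in> {n. int p dvd e' * T n + T (Suc n)} then 1 else 0)"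
proof -
  have p: "0 < p" using assms(1) prime_gt_0_nat by blast
  have T_nz: "\<not> int p dvd T k" for k
  proof (induction k rule: less_induct)
    case (less k)
    show ?case
    proof (cases "k < p")
      case False
      have "k div p < k" "k mod p < p"
        using False p prime_gt_1_nat[OF assms(1)] by (auto intro: div_less_dividend)
      then have "\<not> int p dvd T (k div p) * T (k mod p)"
        using less.IH nz assms(1) by (simp add: prime_dvd_mult_iff)
      then show ?thesis
        using cong_dvd_iff[OF T_Lucas[OF assms(1) \<open>k mod p < p\<close>, of "k div p"]] by simp
    qed (use nz in auto)
  qed
  have low: "int p dvd e * T (p * k + m) + T (Suc (p * k + m)) \<longleftrightarrow> int p dvd e * T m + T (Suc m)"
    if "m < p - 1" for m
  proof -
    have "[e * T (p * k + m) + T (p * k + Suc m) = e * (T k * T m) + T k * T (Suc m)] (mod int p)"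
      by (intro cong_add cong_mult cong_refl T_Lucas assms(1)) (use that in auto)
    also have "e * (T k * T m) + T k * T (Suc m) = T k * (e * T m + T (Suc m))"
      by (simp add: algebra_simps)
    finally have "int p dvd e * T (p * k + m) + T (p * k + Suc m) \<longleftrightarrow>
        int p dvd T k * (e * T m + T (Suc m))"
      by (rule cong_dvd_iff)
    then show ?thesis using T_nz assms(1) by (simp add: prime_dvd_mult_iff)
  qed
  \<comment> \<open>The successor of p k + (p - 1) has last digit 0 and leading part k + 1, and
    \<open>T 0 = 1\<close>.\<close>
  have "[e * T (p * k + (p - 1)) + T (p * Suc k + 0) = e * (T k * T (p - 1)) + T (Suc k) * T 0] (mod int p)"
    by (intro cong_add cong_mult cong_refl T_Lucas assms(1)) (use p in auto)
  also have "e * (T k * T (p - 1)) + T (Suc k) * T 0 = e * T (p - 1) * T k + T (Suc k)"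
    by (simp add: T_0 algebra_simps)
  also have "[\<dots> = e' * T k + T (Suc k)] (mod int p)"
    by (intro cong_add cong_mult cong_refl e)
  finally have "[e * T (p * k + (p - 1)) + T (p * Suc k + 0) = e' * T k + T (Suc k)] (mod int p)" .
  moreover have "p * Suc k + 0 = Suc (p * k + (p - 1))" using p by simp
  ultimately have high: "int p dvd e * T (p * k + (p - 1)) + T (Suc (p * k + (p - 1))) \<longleftrightarrow>
      int p dvd e' * T k + T (Suc k)"
    using cong_dvd_iff by metis
  have "{m. m < p - 1 \<and> int p dvd e * T (p * k + m) + T (Suc (p * k + m))} =
      {m. m < p - 1 \<and> int p dvd e * T m + T (Suc m)}"
    using low by blast
  then show ?thesis
    unfolding card_lessThan_split_last[OF p] mem_Collect_eq high by simp
qed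

theorem proposition16:
  fixes p :: nat
  assumes "prime p"
  shows "((\<exists>n<p. int p dvd T n) \<longrightarrow> has_value_density (\<lambda>n. s n mod int p) 0 1) \<and>
    (\<not> (\<exists>n<p. int p dvd T n) \<and> p > 2 \<longrightarrow>
       has_value_density (\<lambda>n. s n mod int p) 0
         ((real (card {m::nat. m < p - 1 \<and> [T m = - T (p - 1) * T (m + 1)] (mod int p)})
           + real p * real (card {m::nat. m < p - 1 \<and> [T m = - T (m + 1)] (mod int p)}))
          / ((real p - 1) * (real p + 1)))) \<and>
    (p > 2 \<longrightarrow>
       (\<exists>D\<^sub>0. has_value_density (\<lambda>n. s n mod int p) 0 D\<^sub>0 \<and> D\<^sub>0 \<ge> 1 / (real p - 1)))"
proof -
  define A where "A = {m. m < p - 1 \<and> [T m = - T (p - 1) * T (m + 1)] (mod int p)}"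
  define B where "B = {m. m < p - 1 \<and> [T m = - T (m + 1)] (mod int p)}"
  define S where "S e = {n. int p dvd e * T n + T (Suc n)}" for e
  have dvd_s: "{n. s n mod int p = 0} = S 1" if "p > 2"
  proof -
    have "\<not> int p dvd 2" using that by (auto dest: zdvd_imp_le)
    then have "int p dvd s n \<longleftrightarrow> int p dvd 2 * s n" for n
      using assms by (simp add: prime_dvd_mult_iff)
    then show ?thesis by (auto simp: two_s S_def dvd_eq_mod_eq_0)
  qed
  have zero: "has_value_density (\<lambda>n. s n mod int p) 0 1" if ex: "\<exists>n<p. int p dvd T n"
  proof -
    obtain j where j: "j < p" "int p dvd T j" using ex by blast
    \<comment> \<open>For p = 2 the only digits are 0 and 1, where \<open>T\<close> is 1.\<close>
    have "p \<noteq> 2"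
    proof
      assume "p = 2"
      then have "j = 0 \<or> j = 1" using j(1) by auto
      then show False using j(2) \<open>p = 2\<close> by (auto simp: T_0 T_1)
    qed
    then have "p > 2" using prime_ge_2_nat[OF assms] by simp
    have "has_asymptotic_density (S 1) 1"
      by (rule has_asymptotic_density_superset_complement_shift[OF T_dvd_density[OF assms j]])
        (simp add: S_def)
    then show ?thesis by (simp add: has_value_density_def dvd_s[OF \<open>p > 2\<close>])
  qed
  have nonzero: "has_value_density (\<lambda>n. s n mod int p) 0
      ((real (card A) + real p * real (card B)) / ((real p - 1) * (real p + 1))) \<and>
      1 \<le> card A \<and> 1 \<le> card B"
    if ex: "\<not> (\<exists>n<p. int p dvd T n)" and "p > 2"
  proof -
    let ?t = "T (p - 1)"
    have nz: "\<And>n. n < p \<Longrightarrow> \<not> int p dvd T n" using ex by blast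
    have sq: "[?t * ?t = 1] (mod int p)"
      using T_pred_prime_square[OF assms] nz \<open>p > 2\<close> by simp
    have t_nz: "\<not> int p dvd ?t" using nz \<open>p > 2\<close> by simp
    have B: "B = {m. m < p - 1 \<and> int p dvd 1 * T m + T (Suc m)}"
      by (simp add: B_def cong_iff_dvd_diff)
    \<comment> \<open>Multiply by the unit \<open>?t\<close> and use that its square is 1.\<close>
    have A_iff: "[T m = - ?t * T (m + 1)] (mod int p) \<longleftrightarrow> int p dvd ?t * T m + T (Suc m)" for m
    proof -
      have "int p dvd T m + ?t * T (Suc m) \<longleftrightarrow> int p dvd ?t * (T m + ?t * T (Suc m))"
        using t_nz assms by (simp add: prime_dvd_mult_iff)
      also have "[?t * (T m + ?t * T (Suc m)) = ?t * T m + 1 * T (Suc m)] (mod int p)"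
        unfolding distrib_left mult.assoc[symmetric]
        by (intro cong_add cong_mult cong_refl sq)
      then have "int p dvd ?t * (T m + ?t * T (Suc m)) \<longleftrightarrow> int p dvd ?t * T m + 1 * T (Suc m)"
        by (rule cong_dvd_iff)
      finally show ?thesis by (simp add: cong_iff_dvd_diff)
    qed
    have A: "A = {m. m < p - 1 \<and> int p dvd ?t * T m + T (Suc m)}"
      unfolding A_def A_iff ..
    have density: "has_asymptotic_density (S 1)
        ((real (card A) + real p * real (card B)) / ((real p - 1) * (real p + 1)))"
    proof (rule density_digit_swap)
      show "1 < p" using \<open>p > 2\<close> by simp
      show "card {m. m < p \<and> p * k + m \<in> S 1} = card B + (if k \<in> S ?t then 1 else 0)" for k
        unfolding S_def B by (rule T_digit_count[OF assms nz]) simp_all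
      show "card {m. m < p \<and> p * k + m \<in> S ?t} = card A + (if k \<in> S 1 then 1 else 0)" for k
        unfolding S_def A by (rule T_digit_count[OF assms nz sq])
    qed
    \<comment> \<open>\<open>T 2\<close> is 3, so p = 3 belongs to the other case.\<close>
    have "p \<noteq> 3"
    proof
      assume "p = 3"
      have "T (Suc (Suc 0)) = 3" using T_recurrence[of 0] by (simp add: T_0 T_1)
      then show False using nz[of 2] \<open>p = 3\<close> by (simp add: numeral_2_eq_2)
    qed
    then have "p > 3" using \<open>p > 2\<close> by simp
    have "Suc (p - 3) = p - 2" using \<open>p > 3\<close> by simp
    then have in_B: "p - 3 \<in> B"
      using prime_dvd_T_sum[OF assms \<open>p > 3\<close>] \<open>p > 3\<close> by (simp add: B)
    have "A \<noteq> {}"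
    proof -
      have "int p dvd ?t * ?t - 1" using sq by (simp add: cong_iff_dvd_diff)
      then have "int p dvd (?t - 1) * (?t + 1)" by (simp add: algebra_simps)
      then consider "int p dvd ?t - 1" | "int p dvd ?t + 1"
        using assms by (auto simp: prime_dvd_mult_iff)
      then show ?thesis
      proof cases
        case 1
        have "int p dvd 1 * T (p - 3) + T (Suc (p - 3))" using in_B by (simp add: B)
        with 1 have "int p dvd (?t - 1) * T (p - 3) + (1 * T (p - 3) + T (Suc (p - 3)))"
          by (rule dvd_add[OF dvd_mult2])
        also have "(?t - 1) * T (p - 3) + (1 * T (p - 3) + T (Suc (p - 3))) =
            ?t * T (p - 3) + T (Suc (p - 3))"
          by (simp add: algebra_simps)
        finally have "p - 3 \<in> A" using in_B by (simp add: A B)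
        then show ?thesis by blast
      next
        case 2
        then have "0 \<in> A" using \<open>p > 2\<close> by (simp add: A T_0 T_1)
        then show ?thesis by blast
      qed
    qed
    moreover have "finite A" "finite B" by (simp_all add: A_def B_def)
    ultimately have "1 \<le> card A" "1 \<le> card B"
      using in_B by (auto simp: Suc_le_eq card_gt_0_iff)
    then show ?thesis using density by (simp add: has_value_density_def dvd_s[OF \<open>p > 2\<close>])
  qed
  have "\<exists>D\<^sub>0. has_value_density (\<lambda>n. s n mod int p) 0 D\<^sub>0 \<and> D\<^sub>0 \<ge> 1 / (real p - 1)" if "p > 2"
  proof (cases "\<exists>n<p. int p dvd T n")
    case True
    then show ?thesis using zero \<open>p > 2\<close> by (intro exI[of _ 1]) auto
  next
    case False
    then have AB: "1 \<le> real (card A)" "1 \<le> real (card B)" using nonzero \<open>p > 2\<close> by auto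
    have pos: "0 < real p - 1" "0 < real p + 1" using \<open>p > 2\<close> by auto
    \<comment> \<open>Both counts being at least 1, the numerator is at least p + 1, which cancels a
      factor of the denominator.\<close>
    have "real p * 1 \<le> real p * real (card B)" using AB by (intro mult_left_mono) auto
    then have "real p + 1 \<le> real (card A) + real p * real (card B)" using AB by simp
    then have "(real p + 1) / ((real p - 1) * (real p + 1)) \<le>
        (real (card A) + real p * real (card B)) / ((real p - 1) * (real p + 1))"
      using pos by (intro divide_right_mono) auto
    moreover have "(real p + 1) / ((real p - 1) * (real p + 1)) = 1 / (real p - 1)"
      using pos by simp
    ultimately show ?thesis using nonzero[OF False \<open>p > 2\<close>] by (intro exI) auto
  qed
  then show ?thesis using zero nonzero unfolding A_def B_def by blast
qed

end
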